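(* Let $X$ be an infinite-dimensional Banach space, regarded as a topological group with vector addition and the norm topology. Then $X$ cannot be embedded in any product of locally compact groups as a topological group; that is, there is no family $\{G_i\}_{i\in I}$ of locally compact groups for which there exists a group homomorphism $\iota\colon X\to\prod_{i\in I}G_i$ that is a homeomorphism onto its image, where $\prod_{i\in I}G_i$ carries the product topology.
   Context: The locally compact groups $G_i$ are not assumed to be abelian, and the index set $I$ is arbitrary. *)

theory Defs
  imports "HOL-Analysis.Analysis" "HOL-Algebra.Product_Groups"
begin

definition topological_group :: "'g monoid \<Rightarrow> 'g topology \<Rightarrow> bool" where
  "topological_group G T \<longleftrightarrow>
     group G \<and> topspace T = carrier G \<and>
     continuous_map (prod_topology T T) T (\<lambda>(x, y). x \<otimes>\<^bsub>G\<^esub> y) \<and>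
     continuous_map T T (\<lambda>x. inv\<^bsub>G\<^esub> x)"

text \<open>No separation axiom is imposed: \<^const>\<open>locally_compact_space\<close> only asks every point to have a
  compact neighbourhood.  Locally compact groups in the narrower sense, where the Hausdorff property
  is part of the definition, are thus included.\<close>

definition locally_compact_group :: "'g monoid \<Rightarrow> 'g topology \<Rightarrow> bool" where
  "locally_compact_group G T \<longleftrightarrow> topological_group G T \<and> locally_compact_space T"

definition vector_group :: "'a::real_vector monoid" where
  "vector_group = \<lparr>carrier = UNIV, mult = (+), one = 0\<rparr>"

end

theory Submission imports Defs begin

text \<open>Let \<open>\<iota>\<close> be an embedding. The preimage of some basic neighbourhood of the identity lies in the
  unit ball, and such a neighbourhood restricts only finitely many coordinates \<open>i\<close>. In each of these
  coordinates the identity has a compact neighbourhood, which finitely many arbitrarily small sets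
  cover. Pulled back to the vector space, this says that a ball of some radius \<open>r > 0\<close> is covered by
  finitely many sets whose differences lie in any prescribed basic neighbourhood of zero
  (lemmas \<open>ball_finite_small_cover\<close> and \<open>finite_small_cover_INT\<close>).

  The choice of that neighbourhood exploits scaling. Power maps of topological groups are
  continuous, so the differences \<open>d\<close> can be required to be so small that \<open>n d\<close> still lies in
  the preimage that is contained in the unit ball. Then \<open>norm d < 1/n\<close>, where \<open>n\<close> can be taken as large as desired
  after \<open>r\<close> has been fixed. With \<open>1/n \<le> r/2\<close> the ball of radius \<open>r\<close> is covered by finitely many balls
  of half the radius, and their centres span the space
  (lemma \<open>span_eq_UNIV_if_half_cover\<close>).\<close>

section \<open>Balls covered by finitely many balls of half the radius\<close>

text \<open>Repeated halving writes a point of the ball as \<open>\<Sum>k. f k / 2 ^ k\<close> with every \<open>f k\<close> in the finite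
  set \<open>F\<close>. Grouping the terms by their value turns the series into a finite linear combination of
  \<open>F\<close>, whose coefficients are subseries of the geometric series. The limit therefore lies in the
  span of \<open>F\<close> itself and not merely in its closure.\<close>

lemma span_eq_UNIV_if_half_cover:
  fixes F :: "'a::real_normed_vector set"
  assumes "finite F" and "r > 0"
    and cover: "\<And>x. norm x < r \<Longrightarrow> \<exists>a\<in>F. norm (x - a) < r / 2"
  shows "span F = UNIV"
proof -
  have small: "x \<in> span F" if "norm x < r" for x
  proof -
    obtain c where c: "\<And>y. norm y < r \<Longrightarrow> c y \<in> F \<and> norm (y - c y) < r / 2"
      using cover by metis
    \<comment> \<open>The remainder after each step, rescaled by the factor 2 so that it lies in the ball again.\<close>
    define y where "y = rec_nat x (\<lambda>_ z. 2 *\<^sub>R (z - c z))"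
    have y_0: "y 0 = x" and y_Suc: "y (Suc k) = 2 *\<^sub>R (y k - c (y k))" for k
      by (simp_all add: y_def)
    have y_less: "norm (y k) < r" for k
    proof (induction k)
      case (Suc k)
      from c[OF Suc] show ?case by (simp add: y_Suc)
    qed (simp add: y_0 that)
    have partial: "x = (\<Sum>k<n. (1/2)^k *\<^sub>R c (y k)) + (1/2)^n *\<^sub>R y n" for n
    proof (induction n)
      case (Suc n)
      have "(1/2)^n *\<^sub>R y n = (1/2)^n *\<^sub>R c (y n) + (1/2)^Suc n *\<^sub>R y (Suc n)"
        by (simp add: y_Suc scaleR_right_diff_distrib)
      with Suc show ?case by (simp add: add.assoc)
    qed (simp add: y_0)
    have "(\<lambda>n. r * (1/2)^n) \<longlonglongrightarrow> r * 0"
      by (intro tendsto_intros LIMSEQ_realpow_zero) auto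
    moreover have "norm ((1/2)^n *\<^sub>R y n) \<le> r * (1/2)^n" for n
      using mult_left_mono[OF less_imp_le[OF y_less[of n]], of "(1/2)^n"] by (simp add: mult.commute)
    ultimately have "(\<lambda>n. (1/2)^n *\<^sub>R y n) \<longlonglongrightarrow> 0"
      using Lim_null_comparison[of "\<lambda>n. (1/2)^n *\<^sub>R y n" "\<lambda>n. r * (1/2)^n" sequentially] by simp
    then have "(\<lambda>n. x - (1/2)^n *\<^sub>R y n) \<longlonglongrightarrow> x - 0"
      by (rule tendsto_diff[OF tendsto_const])
    moreover have "x - (1/2)^n *\<^sub>R y n = (\<Sum>k<n. (1/2)^k *\<^sub>R c (y k))" for n
      using partial[of n] by (simp add: algebra_simps)
    ultimately have lim_x: "(\<lambda>n. \<Sum>k<n. (1/2)^k *\<^sub>R c (y k)) \<longlonglongrightarrow> x"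
      by simp
    define t where "t a k = (if c (y k) = a then (1/2)^k else 0 :: real)" for a k
    have "summable (t a)" for a
      by (rule summable_comparison_test'[OF summable_geometric[of "1/2::real"]])
        (auto simp: t_def)
    then have "(\<lambda>n. \<Sum>a\<in>F. (\<Sum>k<n. t a k) *\<^sub>R a) \<longlonglongrightarrow> (\<Sum>a\<in>F. suminf (t a) *\<^sub>R a)"
      by (intro tendsto_sum tendsto_scaleR tendsto_const summable_LIMSEQ)
    moreover have "(\<Sum>a\<in>F. (\<Sum>k<n. t a k) *\<^sub>R a) = (\<Sum>k<n. (1/2)^k *\<^sub>R c (y k))" for n
    proof -
      have "(\<Sum>a\<in>F. t a k *\<^sub>R a) = (1/2)^k *\<^sub>R c (y k)" for k
      proof -
        have "(\<Sum>a\<in>F. t a k *\<^sub>R a) = (\<Sum>a\<in>F. if c (y k) = a then (1/2)^k *\<^sub>R a else 0)"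
          by (intro sum.cong) (auto simp: t_def)
        then show ?thesis
          using c[OF y_less[of k]] \<open>finite F\<close> by simp
      qed
      then show ?thesis
        by (simp add: scaleR_sum_left sum.swap[of "\<lambda>a k. t a k *\<^sub>R a" "{..<n}" F])
    qed
    ultimately have "x = (\<Sum>a\<in>F. suminf (t a) *\<^sub>R a)"
      using lim_x LIMSEQ_unique by auto
    then show ?thesis
      by (simp add: span_sum span_scale span_base)
  qed
  have "x \<in> span F" for x
  proof -
    define s where "s = r / (norm x + 1)"
    have pos: "norm x + 1 > 0" by (simp add: add_nonneg_pos)
    then have "s > 0" using \<open>r > 0\<close> by (simp add: s_def)
    have "r * norm x < r * (norm x + 1)" using \<open>r > 0\<close> by simp
    with pos \<open>s > 0\<close> have "norm (s *\<^sub>R x) < r"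
      using \<open>r > 0\<close> by (simp add: s_def pos_divide_less_eq)
    then have "(1 / s) *\<^sub>R (s *\<^sub>R x) \<in> span F"
      by (intro span_scale small)
    with \<open>s > 0\<close> show ?thesis by simp
  qed
  then show ?thesis by blast
qed


section \<open>Covers by small sets\<close>

text \<open>This is total boundedness of \<open>U\<close> at the scale of a single neighbourhood \<open>N\<close> of zero. Smallness is
  measured on differences, and not by translates of \<open>N\<close>, because differences are compatible with
  intersections.\<close>

definition finite_small_cover :: "'a::ab_group_add set \<Rightarrow> 'a set \<Rightarrow> bool" where
  "finite_small_cover U N \<longleftrightarrow>
     (\<exists>C. finite C \<and> U \<subseteq> \<Union>C \<and> (\<forall>A\<in>C. \<forall>x\<in>A. \<forall>y\<in>A. x - y \<in> N))"

lemma finite_small_cover_Int: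
  assumes "finite_small_cover U M" and "finite_small_cover U N"
  shows "finite_small_cover U (M \<inter> N)"
proof -
  obtain C where C: "finite C" "U \<subseteq> \<Union>C" "\<And>A x y. \<lbrakk>A \<in> C; x \<in> A; y \<in> A\<rbrakk> \<Longrightarrow> x - y \<in> M"
    using assms(1) unfolding finite_small_cover_def by metis
  obtain D where D: "finite D" "U \<subseteq> \<Union>D" "\<And>A x y. \<lbrakk>A \<in> D; x \<in> A; y \<in> A\<rbrakk> \<Longrightarrow> x - y \<in> N"
    using assms(2) unfolding finite_small_cover_def by metis
  let ?E = "(\<lambda>(A, B). A \<inter> B) ` (C \<times> D)"
  have "finite ?E" using C(1) D(1) by simp
  moreover have "U \<subseteq> \<Union>?E"
  proof
    fix x assume "x \<in> U"
    with C(2) D(2) obtain A B where "A \<in> C" "x \<in> A" "B \<in> D" "x \<in> B" by blast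
    then show "x \<in> \<Union>?E" by (intro UnionI[of "A \<inter> B"]) auto
  qed
  moreover have "x - y \<in> M \<inter> N" if "E \<in> ?E" "x \<in> E" "y \<in> E" for E x y
  proof -
    from that obtain A B where "A \<in> C" "x \<in> A" "y \<in> A" "B \<in> D" "x \<in> B" "y \<in> B"
      by fast
    then show ?thesis using C(3)[of A x y] D(3)[of B x y] by simp
  qed
  ultimately show ?thesis
    unfolding finite_small_cover_def by (intro exI[of _ ?E] conjI ballI)
qed

lemma finite_small_cover_INT:
  assumes "finite J" and "\<And>i. i \<in> J \<Longrightarrow> finite_small_cover U (N i)"
  shows "finite_small_cover U (\<Inter>i\<in>J. N i)"
  using assms
proof (induction J)
  case empty
  show ?case unfolding finite_small_cover_def by (intro exI[of _ "{U}"]) auto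
next
  case (insert i J)
  then show ?case using finite_small_cover_Int[of U "N i"] by simp
qed

lemma finite_small_cover_subset:
  assumes "finite_small_cover V N" and "U \<subseteq> V"
  shows "finite_small_cover U N"
  using assms unfolding finite_small_cover_def by blast

lemma span_eq_UNIV_if_finite_small_cover:
  fixes N :: "'a::real_normed_vector set"
  assumes "r > 0" and "finite_small_cover (ball 0 r) N" and "N \<subseteq> ball 0 (r / 2)"
  obtains F :: "'a set" where "finite F" "span F = UNIV"
proof -
  obtain C where C: "finite C" "ball 0 r \<subseteq> \<Union>C" "\<And>A x y. \<lbrakk>A \<in> C; x \<in> A; y \<in> A\<rbrakk> \<Longrightarrow> x - y \<in> N"
    using assms(2) unfolding finite_small_cover_def by metis
  define F where "F = (\<lambda>A. SOME a. a \<in> A) ` C"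
  have "\<exists>a\<in>F. norm (x - a) < r / 2" if "norm x < r" for x
  proof -
    from that C(2) obtain A where A: "A \<in> C" "x \<in> A" by (auto simp: subset_iff)
    then have "(SOME a. a \<in> A) \<in> A" by (metis someI)
    with A C(3) \<open>N \<subseteq> ball 0 (r / 2)\<close> have "norm (x - (SOME a. a \<in> A)) < r / 2"
      by (auto simp: subset_iff)
    with A(1) show ?thesis by (auto simp: F_def)
  qed
  moreover have "finite F" using C(1) by (simp add: F_def)
  ultimately show ?thesis
    using span_eq_UNIV_if_half_cover[of F r] \<open>r > 0\<close> that by blast
qed


section \<open>Continuous homomorphisms from a normed space to a group\<close>

lemma continuous_map_group_pow:
  assumes "topological_group G T"
  shows "continuous_map T T (\<lambda>x. x [^]\<^bsub>G\<^esub> (n::nat))"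
proof -
  interpret group G using assms by (simp add: topological_group_def)
  have mult: "continuous_map (prod_topology T T) T (\<lambda>(x, y). x \<otimes>\<^bsub>G\<^esub> y)"
    and top: "topspace T = carrier G"
    using assms by (simp_all add: topological_group_def)
  show ?thesis
  proof (induction n)
    case 0
    then show ?case by (simp add: top)
  next
    case (Suc n)
    then have "continuous_map T (prod_topology T T) (\<lambda>x. (x [^]\<^bsub>G\<^esub> n, x))"
      by (intro continuous_map_pairedI) auto
    from continuous_map_compose[OF this mult] show ?case by (simp add: o_def)
  qed
qed

lemma hom_vector_group_scaleR:
  assumes "group G" and "f \<in> hom vector_group G"
  shows "f (real n *\<^sub>R x) = f x [^]\<^bsub>G\<^esub> n"
proof -
  interpret group G by fact
  have add: "f (u + v) = f u \<otimes>\<^bsub>G\<^esub> f v" and carrier: "f u \<in> carrier G" for u v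
    using assms(2) by (auto simp: hom_def vector_group_def)
  have "f 0 \<otimes>\<^bsub>G\<^esub> f 0 = f 0" using add[of 0 0] by simp
  then have f_0: "f 0 = \<one>\<^bsub>G\<^esub>" using carrier[of 0] by (simp add: l_cancel_one)
  show ?thesis
  proof (induction n)
    case (Suc n)
    have "f (real (Suc n) *\<^sub>R x) = f (real n *\<^sub>R x + x)" by (simp add: scaleR_left_distrib add.commute)
    with Suc show ?case by (simp add: add)
  qed (simp add: f_0)
qed

lemma hom_vector_group_diff:
  assumes "group G" and "f \<in> hom vector_group G"
  shows "f (x - y) = f x \<otimes>\<^bsub>G\<^esub> inv\<^bsub>G\<^esub> f y"
proof -
  interpret group G by fact
  have add: "f (u + v) = f u \<otimes>\<^bsub>G\<^esub> f v" and carrier: "f u \<in> carrier G" for u v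
    using assms(2) by (auto simp: hom_def vector_group_def)
  have "f x = f (x - y) \<otimes>\<^bsub>G\<^esub> f y" using add[of "x - y" y] by simp
  then show ?thesis using carrier by (simp add: inv_solve_right)
qed

lemma open_nhd_small_quotients:
  assumes "topological_group G T" and "openin T W" and "\<one>\<^bsub>G\<^esub> \<in> W" and "k \<in> carrier G"
  obtains A where "openin T A" "k \<in> A" "\<And>x y. \<lbrakk>x \<in> A; y \<in> A\<rbrakk> \<Longrightarrow> x \<otimes>\<^bsub>G\<^esub> inv\<^bsub>G\<^esub> y \<in> W"
proof -
  interpret group G using assms(1) by (simp add: topological_group_def)
  let ?q = "\<lambda>p. fst p \<otimes>\<^bsub>G\<^esub> inv\<^bsub>G\<^esub> (snd p)"
  have mult: "continuous_map (prod_topology T T) T (\<lambda>(x, y). x \<otimes>\<^bsub>G\<^esub> y)"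
    and inv: "continuous_map T T (\<lambda>x. inv\<^bsub>G\<^esub> x)"
    and top: "topspace T = carrier G"
    using assms(1) by (simp_all add: topological_group_def)
  have "continuous_map (prod_topology T T) (prod_topology T T) (\<lambda>p. (fst p, inv\<^bsub>G\<^esub> (snd p)))"
    using continuous_map_compose[OF continuous_map_snd inv]
    by (intro continuous_map_pairedI continuous_map_fst) (simp add: o_def)
  from continuous_map_compose[OF this mult] have "continuous_map (prod_topology T T) T ?q"
    by (simp add: o_def)
  then have "openin (prod_topology T T) {p \<in> topspace (prod_topology T T). ?q p \<in> W}" (is "openin _ ?S")
    using assms(2) by (rule openin_continuous_map_preimage)
  then have "\<forall>x y. (x, y) \<in> ?S \<longrightarrow>
      (\<exists>A B. openin T A \<and> openin T B \<and> x \<in> A \<and> y \<in> B \<and> A \<times> B \<subseteq> ?S)"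
    by (rule openin_prod_topology_alt[THEN iffD1])
  moreover have "(k, k) \<in> ?S"
    using assms(3,4) by (simp add: top)
  ultimately have "\<exists>A B. openin T A \<and> openin T B \<and> k \<in> A \<and> k \<in> B \<and> A \<times> B \<subseteq> ?S"
    by (elim allE impE)
  then obtain A B where AB: "openin T A" "openin T B" "k \<in> A" "k \<in> B" "A \<times> B \<subseteq> ?S"
    by (elim exE conjE)
  show ?thesis
  proof (rule that[of "A \<inter> B"])
    show "openin T (A \<inter> B)" using AB(1,2) by (rule openin_Int)
    show "k \<in> A \<inter> B" using AB(3,4) by simp
    fix x y assume "x \<in> A \<inter> B" "y \<in> A \<inter> B"
    then have "(x, y) \<in> ?S" using AB(5) by blast
    then show "x \<otimes>\<^bsub>G\<^esub> inv\<^bsub>G\<^esub> y \<in> W" by simp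
  qed
qed

text \<open>The radius comes from a compact neighbourhood of the identity, and so it does not depend on the
  neighbourhood \<open>W\<close> that measures smallness. A compact set is covered by finitely many open sets
  that are small with respect to \<open>W\<close>, and the cover of the ball is pulled back from these.\<close>

lemma ball_finite_small_cover:
  fixes f :: "'a::real_normed_vector \<Rightarrow> 'g"
  assumes "locally_compact_group G T" and hom: "f \<in> hom vector_group G"
    and cont: "continuous_map euclidean T f"
  shows "\<exists>r>0. \<forall>W. openin T W \<longrightarrow> \<one>\<^bsub>G\<^esub> \<in> W \<longrightarrow> finite_small_cover (ball 0 r) (f -` W)"
proof -
  have tg: "topological_group G T" and "locally_compact_space T"
    using assms(1) by (simp_all add: locally_compact_group_def)
  interpret group G using tg by (simp add: topological_group_def)
  have top: "topspace T = carrier G" using tg by (simp add: topological_group_def)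
  obtain U K where UK: "openin T U" "compactin T K" "\<one>\<^bsub>G\<^esub> \<in> U" "U \<subseteq> K"
    using \<open>locally_compact_space T\<close> unfolding locally_compact_space_def top by blast
  have "f 0 = \<one>\<^bsub>G\<^esub>"
    using hom_vector_group_scaleR[OF group_axioms hom, of 0 0] by simp
  moreover have "open (f -` U)"
    using openin_continuous_map_preimage[OF cont UK(1)] by (simp add: vimage_def)
  ultimately obtain r where r: "r > 0" "ball 0 r \<subseteq> f -` U"
    using UK(3) open_contains_ball by (metis vimageI)
  have "finite_small_cover (ball 0 r) (f -` W)" if W: "openin T W" "\<one>\<^bsub>G\<^esub> \<in> W" for W
  proof -
    define \<A> where "\<A> = {A. openin T A \<and> (\<forall>x\<in>A. \<forall>y\<in>A. x \<otimes>\<^bsub>G\<^esub> inv\<^bsub>G\<^esub> y \<in> W)}"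
    have "\<exists>A\<in>\<A>. k \<in> A" if "k \<in> K" for k
    proof -
      have "k \<in> carrier G" using that UK(2) top compactin_subset_topspace by blast
      then show ?thesis
        by (rule open_nhd_small_quotients[OF tg W]) (auto simp: \<A>_def)
    qed
    then have "K \<subseteq> \<Union>\<A>" by blast
    moreover have "openin T A" if "A \<in> \<A>" for A using that by (simp add: \<A>_def)
    ultimately obtain \<F> where F: "finite \<F>" "\<F> \<subseteq> \<A>" "K \<subseteq> \<Union>\<F>"
      using compactinD[OF UK(2)] by metis
    show ?thesis unfolding finite_small_cover_def
    proof (intro exI[of _ "vimage f ` \<F>"] conjI ballI)
      show "finite (vimage f ` \<F>)" using F(1) by simp
      show "ball 0 r \<subseteq> \<Union>(vimage f ` \<F>)"
      proof
        fix x :: 'a assume "x \<in> ball 0 r"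
        then have "f x \<in> K" using r(2) UK(4) by blast
        then show "x \<in> \<Union>(vimage f ` \<F>)" using F(3) by blast
      qed
      fix A and x y :: 'a assume "A \<in> vimage f ` \<F>" and "x \<in> A" and "y \<in> A"
      then obtain B where "B \<in> \<A>" "f x \<in> B" "f y \<in> B" using F(2) by blast
      then have "f x \<otimes>\<^bsub>G\<^esub> inv\<^bsub>G\<^esub> f y \<in> W" by (simp add: \<A>_def)
      then show "x - y \<in> f -` W" by (simp add: hom_vector_group_diff[OF group_axioms hom])
    qed
  qed
  with r(1) show ?thesis by (intro exI[of _ r] conjI allI impI)
qed

text \<open>Continuity of the power map lets smallness be required of the multiple \<open>n d\<close> of a difference
  \<open>d\<close>, with the same radius for all \<open>n\<close>.\<close>

lemma ball_finite_small_cover_multiples: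
  fixes f :: "'a::real_normed_vector \<Rightarrow> 'g"
  assumes "locally_compact_group G T" and hom: "f \<in> hom vector_group G"
    and "continuous_map euclidean T f" and "openin T V" and "\<one>\<^bsub>G\<^esub> \<in> V"
  shows "\<exists>r>0. \<forall>n. finite_small_cover (ball 0 r) {d. f (real n *\<^sub>R d) \<in> V}"
proof -
  have tg: "topological_group G T" using assms(1) by (simp add: locally_compact_group_def)
  interpret group G using tg by (simp add: topological_group_def)
  obtain r where r: "r > 0"
    "\<forall>W. openin T W \<longrightarrow> \<one>\<^bsub>G\<^esub> \<in> W \<longrightarrow> finite_small_cover (ball 0 r) (f -` W)"
    using ball_finite_small_cover[OF assms(1-3)] by (elim exE conjE)
  have top: "topspace T = carrier G" using tg by (simp add: topological_group_def)
  have "finite_small_cover (ball 0 r) {d. f (real n *\<^sub>R d) \<in> V}" for n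
  proof -
    let ?W = "{x \<in> topspace T. x [^]\<^bsub>G\<^esub> n \<in> V}"
    have "openin T ?W"
      using continuous_map_group_pow[OF tg] assms(4) by (rule openin_continuous_map_preimage)
    moreover have "\<one>\<^bsub>G\<^esub> \<in> ?W" using assms(5) by (simp add: top)
    ultimately have "finite_small_cover (ball 0 r) (f -` ?W)" by (rule r(2)[rule_format])
    moreover have "f -` ?W = {d. f (real n *\<^sub>R d) \<in> V}"
    proof -
      have "f d \<in> carrier G" for d using hom by (auto simp: hom_def vector_group_def)
      then show ?thesis by (simp add: vimage_def top hom_vector_group_scaleR[OF group_axioms hom])
    qed
    ultimately show ?thesis by simp
  qed
  with r(1) show ?thesis by blast
qed


section \<open>Embeddings into products\<close>

lemma embedding_map_product_bounded_nhd:
  fixes \<iota> :: "'a::real_normed_vector \<Rightarrow> 'i \<Rightarrow> 'g"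
  assumes emb: "embedding_map euclidean (product_topology T I) \<iota>"
  obtains J V where "finite J" "J \<subseteq> I"
    "\<And>i. i \<in> J \<Longrightarrow> openin (T i) (V i) \<and> \<iota> 0 i \<in> V i"
    "\<And>x. \<forall>i\<in>J. \<iota> x i \<in> V i \<Longrightarrow> norm x < 1"
proof -
  let ?P = "product_topology T I"
  have hm: "homeomorphic_map euclidean (subtopology ?P (range \<iota>)) \<iota>"
    using emb by (simp add: embedding_map_def)
  have "inj \<iota>" using homeomorphic_imp_injective_map[OF hm] by simp
  have "continuous_map euclidean ?P \<iota>"
    using homeomorphic_imp_continuous_map[OF hm] by (rule continuous_map_into_fulltopology)
  then have in_top: "\<iota> x \<in> topspace ?P" for x
    by (auto simp: continuous_map_def Pi_iff)
  have "openin (subtopology ?P (range \<iota>)) (\<iota> ` ball 0 1)"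
    using homeomorphic_imp_open_map[OF hm] by (simp add: open_map_def)
  then obtain O' where O': "openin ?P O'" "\<iota> ` ball 0 1 = O' \<inter> range \<iota>"
    unfolding openin_subtopology by blast
  have "\<iota> 0 \<in> \<iota> ` ball 0 1" by simp
  then have "\<iota> 0 \<in> O'" using O'(2) by blast
  from product_topology_open_contains_basis[OF O'(1) this]
  obtain V where V: "\<iota> 0 \<in> Pi\<^sub>E I V" "\<And>i. openin (T i) (V i)"
      "finite {i. V i \<noteq> topspace (T i)}" "Pi\<^sub>E I V \<subseteq> O'"
    by (elim exE conjE) simp
  let ?J = "{i \<in> I. V i \<noteq> topspace (T i)}"
  show ?thesis
  proof (rule that[of ?J V])
    show "finite ?J" using V(3) by (rule rev_finite_subset) auto
    show "norm x < 1" if "\<forall>i\<in>?J. \<iota> x i \<in> V i" for x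
    proof -
      have "\<iota> x \<in> Pi\<^sub>E I V"
      proof (rule PiE_I)
        fix i assume "i \<in> I"
        then show "\<iota> x i \<in> V i"
          using that in_top[of x] by (cases "V i = topspace (T i)") (auto simp: PiE_iff)
      next
        fix i assume "i \<notin> I"
        then show "\<iota> x i = undefined" using in_top[of x] by (auto simp: PiE_iff extensional_def)
      qed
      then have "\<iota> x \<in> \<iota> ` ball 0 1" using V(4) O'(2) by blast
      then show ?thesis using \<open>inj \<iota>\<close> by (auto simp: inj_image_mem_iff)
    qed
  qed (use V in auto)
qed

theorem theorem7p1:
  assumes infinite_dimensional: "\<nexists>B :: 'a::banach set. finite B \<and> span B = UNIV"
  shows "\<nexists>(I :: 'i set) (G :: 'i \<Rightarrow> 'g monoid) (T :: 'i \<Rightarrow> 'g topology) (\<iota> :: 'a \<Rightarrow> 'i \<Rightarrow> 'g).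
           (\<forall>i\<in>I. locally_compact_group (G i) (T i)) \<and>
           \<iota> \<in> hom vector_group (product_group I G) \<and>
           embedding_map euclidean (product_topology T I) \<iota>"
proof (intro notI, elim exE conjE)
  fix I :: "'i set" and G :: "'i \<Rightarrow> 'g monoid" and T :: "'i \<Rightarrow> 'g topology"
    and \<iota> :: "'a \<Rightarrow> 'i \<Rightarrow> 'g"
  assume "\<forall>i\<in>I. locally_compact_group (G i) (T i)"
    and hom: "\<iota> \<in> hom vector_group (product_group I G)"
    and emb: "embedding_map euclidean (product_topology T I) \<iota>"
  then have lcg: "locally_compact_group (G i) (T i)" if "i \<in> I" for i
    using that by blast
  have grp: "group (G i)" if "i \<in> I" for i
    using lcg[OF that] by (simp add: locally_compact_group_def topological_group_def)
  have hom_i: "(\<lambda>x. \<iota> x i) \<in> hom vector_group (G i)" if "i \<in> I" for i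
    using hom that by (auto simp: hom_def vector_group_def PiE_iff Pi_iff)
  have "continuous_map euclidean (product_topology T I) \<iota>"
    using emb unfolding embedding_map_def
    by (blast intro: homeomorphic_imp_continuous_map continuous_map_into_fulltopology)
  then have cont_i: "continuous_map euclidean (T i) (\<lambda>x. \<iota> x i)" if "i \<in> I" for i
    using that by (simp add: continuous_map_componentwise)
  obtain J V where J: "finite J" "J \<subseteq> I"
    and V: "\<And>i. i \<in> J \<Longrightarrow> openin (T i) (V i) \<and> \<iota> 0 i \<in> V i"
    and bounded: "\<And>x. \<forall>i\<in>J. \<iota> x i \<in> V i \<Longrightarrow> norm x < 1"
    using embedding_map_product_bounded_nhd[OF emb] by metis
  define N where "N n i = {d. \<iota> (real n *\<^sub>R d) i \<in> V i}" for n i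
  have "\<exists>r>0. \<forall>n. finite_small_cover (ball 0 r) (N n i)" if "i \<in> J" for i
  proof -
    have "i \<in> I" using that J(2) by blast
    have "\<iota> 0 i = \<one>\<^bsub>G i\<^esub>"
      using hom_vector_group_scaleR[OF grp hom_i, of i 0 0] \<open>i \<in> I\<close> by simp
    with V[OF that] have "openin (T i) (V i)" "\<one>\<^bsub>G i\<^esub> \<in> V i"
      by auto
    from ball_finite_small_cover_multiples[OF lcg hom_i cont_i this] \<open>i \<in> I\<close> show ?thesis
      unfolding N_def by blast
  qed
  then obtain \<rho> where \<rho>: "\<And>i. i \<in> J \<Longrightarrow> \<rho> i > 0"
      "\<And>i n. i \<in> J \<Longrightarrow> finite_small_cover (ball 0 (\<rho> i)) (N n i)"
    by metis
  \<comment> \<open>Inserting 1 keeps the minimum meaningful when no coordinate is restricted.\<close>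
  define r where "r = Min (insert 1 (\<rho> ` J))"
  have r_le: "r \<le> \<rho> i" if "i \<in> J" for i
    using \<rho>(1) J(1) that by (auto simp: r_def)
  have "r > 0" using \<rho>(1) J(1) by (auto simp: r_def)
  obtain n :: nat where n: "2 / r < real n" using reals_Archimedean2 by blast
  moreover have "2 / r > 0" using \<open>r > 0\<close> by simp
  ultimately have "n > 0" by linarith
  have "finite_small_cover (ball 0 r) (N n i)" if "i \<in> J" for i
    using finite_small_cover_subset[OF \<rho>(2)[OF that] subset_ball[OF r_le[OF that]]] .
  with J(1) have "finite_small_cover (ball 0 r) (\<Inter>i\<in>J. N n i)"
    by (rule finite_small_cover_INT)
  moreover have "(\<Inter>i\<in>J. N n i) \<subseteq> ball 0 (r / 2)"
  proof
    fix d assume "d \<in> (\<Inter>i\<in>J. N n i)"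
    then have "\<forall>i\<in>J. \<iota> (real n *\<^sub>R d) i \<in> V i" by (simp add: N_def)
    then have "real n * norm d < 1" using bounded[of "real n *\<^sub>R d"] by simp
    also have "1 < real n * (r / 2)"
      using n \<open>r > 0\<close> by (simp add: pos_divide_less_eq)
    finally have "norm d < r / 2" using \<open>n > 0\<close> by simp
    then show "d \<in> ball 0 (r / 2)" by simp
  qed
  ultimately obtain F :: "'a set" where "finite F" "span F = UNIV"
    by (rule span_eq_UNIV_if_finite_small_cover[OF \<open>r > 0\<close>])
  with infinite_dimensional show False by blast
qed

end
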